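(* Let $a,b,c$ be real numbers, not all zero, and let $\{\mathcal{J}g_{n}^{(3)}\}_{n\geq 0}$ be the generalized Gaussian third-order Jacobsthal sequence with parameters $a,b,c$. Then for every non-negative integer $n$, $$ \sum_{l=0}^{n}\mathcal{J}g_{l}^{(3)}=\frac{1}{3}\left[\mathcal{J}g_{n+2}^{(3)}+2\mathcal{J}g_{n}^{(3)}+(a-c)+\frac{1}{2}(c-3b-a)i\right]. $$
   Context: Here $i$ is the imaginary unit. The generalized Gaussian third-order Jacobsthal sequence with real parameters $a,b,c$ (not all zero) is the sequence of complex numbers defined by $\mathcal{J}g_{n+3}^{(3)}=\mathcal{J}g_{n+2}^{(3)}+\mathcal{J}g_{n+1}^{(3)}+2\mathcal{J}g_{n}^{(3)}$ for $n\ge 0$, with $\mathcal{J}g_{0}^{(3)}=a+\frac{1}{2}(c-b-a)i$, $\mathcal{J}g_{1}^{(3)}=b+ai$, $\mathcal{J}g_{2}^{(3)}=c+bi$. *)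

theory Defs
  imports Complex_Main
begin

fun gen_gauss_jacobsthal3 :: "real \<Rightarrow> real \<Rightarrow> real \<Rightarrow> nat \<Rightarrow> complex" where
  "gen_gauss_jacobsthal3 a b c 0 = of_real a + of_real ((c - b - a) / 2) * \<i>"
| "gen_gauss_jacobsthal3 a b c (Suc 0) = of_real b + of_real a * \<i>"
| "gen_gauss_jacobsthal3 a b c (Suc (Suc 0)) = of_real c + of_real b * \<i>"
| "gen_gauss_jacobsthal3 a b c (Suc (Suc (Suc n))) =
     gen_gauss_jacobsthal3 a b c (Suc (Suc n)) + gen_gauss_jacobsthal3 a b c (Suc n)
       + 2 * gen_gauss_jacobsthal3 a b c n"

end

theory Submission
  imports Defs
begin

text \<open>The sum telescopes: by the recurrence, \<open>J(n+3) + 2 J(n+1)\<close> exceeds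
  \<open>J(n+2) + 2 J(n)\<close> by exactly \<open>3 J(n+1)\<close>, so induction on
  \<open>n\<close> suffices.\<close>

theorem theorem2p12:
  fixes a b c :: real and n :: nat
  assumes "\<not> (a = 0 \<and> b = 0 \<and> c = 0)"
  shows "(\<Sum>l=0..n. gen_gauss_jacobsthal3 a b c l) =
    (1 / 3) * (gen_gauss_jacobsthal3 a b c (n + 2) + 2 * gen_gauss_jacobsthal3 a b c n
      + of_real (a - c) + of_real ((c - 3 * b - a) / 2) * \<i>)"
proof (induction n)
  case 0
  \<comment> \<open>The case \<open>n = 0\<close> fixes the additive constant: it must be
    \<open>J(0) - J(2)\<close>, whose imaginary part is \<open>(c - b - a)/2 - b\<close>.\<close>
  show ?case by (simp add: numeral_2_eq_2 complex_eq_iff field_simps)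
next
  case (Suc n)
  \<comment> \<open>The only instance of the recurrence that the telescoping needs.\<close>
  have "gen_gauss_jacobsthal3 a b c (Suc n + 2) =
      gen_gauss_jacobsthal3 a b c (n + 2) + gen_gauss_jacobsthal3 a b c (Suc n)
        + 2 * gen_gauss_jacobsthal3 a b c n"
    by simp
  with Suc.IH show ?case by (simp only: sum.atLeast0_atMost_Suc) (simp add: field_simps)
qed

end
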